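(* Let $G$ be a group and let $\mu$ be the unique bi-invariant probability measure on $\mathcal{B}^{\mathrm{st}}_G$. \begin{enumerate} \item[(a)] If $A,B\in\mathcal{B}^{\mathrm{st}}_G$ and $A\cup B$ is generic, then $A$ is generic or $B$ is generic. \item[(b)] If $A\in\mathcal{B}^{\mathrm{st}}_G$ then $A$ is generic or $G\setminus A$ is generic. \item[(c)] If $A\in\mathcal{B}^{\mathrm{st}}_G$ then $\mu(A^{-1})=\mu(A)$. \item[(d)] For $A\in\mathcal{B}^{\mathrm{st}}_G$ the following are equivalent: (i) $A$ is generic, i.e. $G=FA$ for some finite $F\subseteq G$; (ii) $G=AF$ for some finite $F\subseteq G$; (iii) $G=EAF$ for some finite $E,F\subseteq G$; (iv) $\mu(A)>0$. \end{enumerate}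
   Context: $A\subseteq G$ is stable in $G$ if there do not exist an infinite linearly ordered set $I$ and sequences $(a_i)_{i\in I},(b_i)_{i\in I}$ in $G$ with $a_ib_j\in A$ iff $i\le j$. $\mathcal{B}^{\mathrm{st}}_G$ is the set of all stable subsets of $G$; it is a bi-invariant Boolean algebra closed under $A\mapsto A^{-1}$ and containing all subgroups. $A$ is generic if $G=FA$ for a finite $F\subseteq G$. A probability measure on $\mathcal{B}^{\mathrm{st}}_G$ is a finitely additive $\mu:\mathcal{B}^{\mathrm{st}}_G\to[0,1]$ with $\mu(G)=1$; bi-invariant means $\mu(gA)=\mu(Ag)=\mu(A)$ for all $g$. It is a fact (used as given) that there is exactly one bi-invariant probability measure on $\mathcal{B}^{\mathrm{st}}_G$. *)

theory Defs
  imports Complex_Main "HOL-Algebra.Coset"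
begin

(* The index set ranges over subsets of the element type of G; the lemma no_order_of_stable_set
   below shows that this loses no generality, because the condition forces a to be injective. *)
definition stable_set :: "('a, 'm) monoid_scheme \<Rightarrow> 'a set \<Rightarrow> bool" where
  "stable_set G A \<longleftrightarrow>
     \<not> (\<exists>(I :: 'a set) r a b. infinite I \<and> linear_order_on I r \<and>
          a \<in> I \<rightarrow> carrier G \<and> b \<in> I \<rightarrow> carrier G \<and>
          (\<forall>i\<in>I. \<forall>j\<in>I. a i \<otimes>\<^bsub>G\<^esub> b j \<in> A \<longleftrightarrow> (i, j) \<in> r))"

lemma no_order_of_stable_set:
  fixes G :: "('a, 'm) monoid_scheme" and I :: "'i set"
  assumes "stable_set G A" and "infinite I" and r: "linear_order_on I r"
    and ab: "a \<in> I \<rightarrow> carrier G" "b \<in> I \<rightarrow> carrier G"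
    and iff: "\<forall>i\<in>I. \<forall>j\<in>I. a i \<otimes>\<^bsub>G\<^esub> b j \<in> A \<longleftrightarrow> (i, j) \<in> r"
  shows False
proof -
  have part: "refl_on I r" "r \<subseteq> I \<times> I" "trans r" "antisym r" "total_on I r"
    using r by (simp_all add: order_on_defs)
  have inj: "inj_on a I"
  proof (rule inj_onI)
    fix i j assume ij: "i \<in> I" "j \<in> I" and eq: "a i = a j"
    have same: "(i, k) \<in> r \<longleftrightarrow> (j, k) \<in> r" if "k \<in> I" for k
      using iff[rule_format, OF ij(1) that, unfolded eq] iff[rule_format, OF ij(2) that]
      by (rule trans[OF sym])
    have "(i, i) \<in> r" "(j, j) \<in> r" using part(1) ij by (simp_all add: refl_onD)
    then have "(j, i) \<in> r" "(i, j) \<in> r" using same[OF ij(1)] same[OF ij(2)] by iprover+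
    then show "i = j" using part(4) by (simp add: antisymD)
  qed
  define c where "c = inv_into I a"
  define s where "s = {(x, y). x \<in> a ` I \<and> y \<in> a ` I \<and> (c x, c y) \<in> r}"
  have cI: "c x \<in> I" and ac: "a (c x) = x" if "x \<in> a ` I" for x
    using that by (simp_all only: c_def inv_into_into f_inv_into_f)
  have "linear_order_on (a ` I) s"
    unfolding order_on_defs
  proof (intro conjI)
    show "s \<subseteq> a ` I \<times> a ` I" by (auto simp: s_def)
    show "refl_on (a ` I) s"
      using cI part(1) by (simp add: s_def refl_on_def)
    show "trans s"
      unfolding s_def by (rule transI) (blast intro: transD[OF part(3)])
    show "antisym s"
    proof (rule antisymI)
      fix x y assume "(x, y) \<in> s" "(y, x) \<in> s"
      then have xy: "x \<in> a ` I" "y \<in> a ` I" "(c x, c y) \<in> r" "(c y, c x) \<in> r"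
        by (simp_all add: s_def)
      then have "c x = c y" using part(4) by (simp add: antisymD)
      then show "x = y" using ac[OF xy(1)] ac[OF xy(2)] by metis
    qed
    show "total_on (a ` I) s"
    proof (rule total_onI)
      fix x y assume xy: "x \<in> a ` I" "y \<in> a ` I" "x \<noteq> y"
      then have "c x \<noteq> c y" using ac[OF xy(1)] ac[OF xy(2)] by metis
      then have "(c x, c y) \<in> r \<or> (c y, c x) \<in> r"
        using part(5) cI[OF xy(1)] cI[OF xy(2)] by (simp add: total_on_def)
      then show "(x, y) \<in> s \<or> (y, x) \<in> s" using xy by (simp add: s_def)
    qed
  qed
  moreover have "infinite (a ` I)" using inj \<open>infinite I\<close> by (simp add: finite_image_iff)
  moreover have "(\<lambda>x. x) \<in> a ` I \<rightarrow> carrier G" using ab(1) by blast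
  moreover have "(\<lambda>x. b (c x)) \<in> a ` I \<rightarrow> carrier G" using ab(2) cI by (simp add: Pi_iff)
  moreover have "\<forall>x\<in>a ` I. \<forall>y\<in>a ` I. x \<otimes>\<^bsub>G\<^esub> b (c y) \<in> A \<longleftrightarrow> (x, y) \<in> s"
  proof (intro ballI)
    fix x y assume xy: "x \<in> a ` I" "y \<in> a ` I"
    have "a (c x) \<otimes>\<^bsub>G\<^esub> b (c y) \<in> A \<longleftrightarrow> (c x, c y) \<in> r"
      using iff cI[OF xy(1)] cI[OF xy(2)] by blast
    moreover have "(x, y) \<in> s \<longleftrightarrow> (c x, c y) \<in> r" using xy by (simp add: s_def)
    ultimately show "x \<otimes>\<^bsub>G\<^esub> b (c y) \<in> A \<longleftrightarrow> (x, y) \<in> s"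
      by (simp only: ac[OF xy(1)])
  qed
  ultimately have "\<not> stable_set G A"
    unfolding stable_set_def not_not
    by (intro exI[of _ "a ` I"] exI[of _ s] exI[of _ "\<lambda>x. x"] exI[of _ "\<lambda>x. b (c x)"] conjI)
  then show False using assms(1) by contradiction
qed

definition stable_sets :: "('a, 'm) monoid_scheme \<Rightarrow> 'a set set" where
  "stable_sets G = {A. A \<subseteq> carrier G \<and> stable_set G A}"

definition generic :: "('a, 'm) monoid_scheme \<Rightarrow> 'a set \<Rightarrow> bool" where
  "generic G A \<longleftrightarrow> (\<exists>F. finite F \<and> F \<subseteq> carrier G \<and> carrier G = F <#>\<^bsub>G\<^esub> A)"

(* Measures on the stable sets are total functions on sets whose values outside
   stable_sets G are unconstrained and irrelevant. *)
definition stable_prob_measure ::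
    "('a, 'm) monoid_scheme \<Rightarrow> ('a set \<Rightarrow> real) \<Rightarrow> bool" where
  "stable_prob_measure G \<mu> \<longleftrightarrow>
     (\<forall>A\<in>stable_sets G. 0 \<le> \<mu> A \<and> \<mu> A \<le> 1) \<and>
     \<mu> (carrier G) = 1 \<and>
     (\<forall>A\<in>stable_sets G. \<forall>B\<in>stable_sets G. A \<inter> B = {} \<longrightarrow> \<mu> (A \<union> B) = \<mu> A + \<mu> B)"

definition bi_invariant ::
    "('a, 'm) monoid_scheme \<Rightarrow> ('a set \<Rightarrow> real) \<Rightarrow> bool" where
  "bi_invariant G \<mu> \<longleftrightarrow>
     (\<forall>A\<in>stable_sets G. \<forall>g\<in>carrier G.
        \<mu> (g <#\<^bsub>G\<^esub> A) = \<mu> A \<and> \<mu> (A #>\<^bsub>G\<^esub> g) = \<mu> A)"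

end

theory Submission
  imports Defs "HOL-Library.Ramsey" "HOL-Analysis.Sigma_Algebra"
begin

text \<open>
  By Ramsey's theorem, \<open>A\<close> is unstable iff there are sequences \<open>a\<close>, \<open>b\<close> in \<open>G\<close> such that for all
  \<open>i < j\<close> exactly one of \<open>a\<^sub>i b\<^sub>j\<close> and \<open>a\<^sub>j b\<^sub>i\<close> lies in \<open>A\<close>. This symmetric condition makes the
  closure properties of the stable sets evident.

  The heart of the theorem is that a stable set \<open>A\<close> with \<open>\<mu> A > 0\<close> is generic. If \<open>A\<close> is not
  generic, then any finite subset of \<open>G\<close> is avoided by some right translate of \<open>A\<close>. Choose translates
  \<open>A\<^sub>0, A\<^sub>1, \<dots>\<close> successively, each avoiding one chosen point from every nonempty intersection of
  previous ones. The translates all have the same positive measure, so some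
  subsequence has nonempty finite intersections, and the points chosen in
  these intersections form an infinite half-graph with the translates. Part (c) is uniqueness of \<open>\<mu>\<close>,
  and everything else follows from additivity.
\<close>

section \<open>Finitely additive measures\<close>

locale finitely_additive_measure = algebra +
  fixes \<mu> :: "'a set \<Rightarrow> real"
  assumes nonneg: "A \<in> M \<Longrightarrow> 0 \<le> \<mu> A"
    and additive: "A \<in> M \<Longrightarrow> B \<in> M \<Longrightarrow> A \<inter> B = {} \<Longrightarrow> \<mu> (A \<union> B) = \<mu> A + \<mu> B"
begin

lemma measure_empty: "\<mu> {} = 0"
  using additive[of "{}" "{}"] by simp

lemma measure_mono:
  assumes "A \<in> M" "B \<in> M" "A \<subseteq> B"
  shows "\<mu> A \<le> \<mu> B"
proof -
  have "A \<union> (B - A) = B" using assms by blast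
  then show ?thesis
    using additive[of A "B - A"] nonneg[of "B - A"] Diff[OF assms(2,1)] assms(1) by simp
qed

lemma measure_Un:
  assumes "A \<in> M" "B \<in> M"
  shows "\<mu> (A \<union> B) = \<mu> A + \<mu> B - \<mu> (A \<inter> B)"
proof -
  have "A \<union> (B - A) = A \<union> B" "(B - A) \<union> (A \<inter> B) = B" by blast+
  moreover have "\<mu> (A \<union> (B - A)) = \<mu> A + \<mu> (B - A)"
    by (rule additive) (use assms in auto)
  moreover have "\<mu> ((B - A) \<union> (A \<inter> B)) = \<mu> (B - A) + \<mu> (A \<inter> B)"
    by (rule additive) (use assms in auto)
  ultimately show ?thesis by simp
qed

lemma measure_UN_le:
  assumes "finite I" "\<And>i. i \<in> I \<Longrightarrow> E i \<in> M"
  shows "\<mu> (\<Union>i\<in>I. E i) \<le> (\<Sum>i\<in>I. \<mu> (E i))"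
  using assms
proof (induction I)
  case empty
  then show ?case by (simp add: measure_empty)
next
  case (insert i I)
  then have M: "E i \<in> M" "(\<Union>i\<in>I. E i) \<in> M" by (simp_all add: finite_UN)
  then have "\<mu> (E i \<union> (\<Union>i\<in>I. E i)) \<le> \<mu> (E i) + \<mu> (\<Union>i\<in>I. E i)"
    using measure_Un[OF M] nonneg[OF Int[OF M]] by (simp del: UN_simps)
  with insert show ?case by auto
qed

text \<open>A crude Bonferroni bound. Adding the sets one at a time, each new set contributes at
  least \<open>\<delta>\<close> and loses at most \<open>\<epsilon>\<close> to each earlier one, so
  the total loss is at most \<open>(card I)^2 * \<epsilon>\<close>.\<close>

lemma measure_UN_ge:
  fixes \<delta> \<epsilon> :: real
  assumes "finite I" "\<And>i. i \<in> I \<Longrightarrow> E i \<in> M" "\<And>i. i \<in> I \<Longrightarrow> \<delta> \<le> \<mu> (E i)" "0 \<le> \<epsilon>"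
    and "\<And>i j. i \<in> I \<Longrightarrow> j \<in> I \<Longrightarrow> i \<noteq> j \<Longrightarrow> \<mu> (E i \<inter> E j) \<le> \<epsilon>"
  shows "card I * (\<delta> - card I * \<epsilon>) \<le> \<mu> (\<Union>i\<in>I. E i)"
  using assms
proof (induction I)
  case empty
  then show ?case by (simp add: measure_empty)
next
  case (insert i I)
  let ?U = "\<Union>i\<in>I. E i" and ?n = "real (card I)"
  have M: "E i \<in> M" "?U \<in> M"
    using insert.prems(1) insert.hyps(1) by (simp_all add: finite_UN)
  have "\<mu> (E i \<inter> ?U) = \<mu> (\<Union>j\<in>I. E i \<inter> E j)" by (simp only: Int_UN_distrib)
  also have "\<dots> \<le> (\<Sum>j\<in>I. \<mu> (E i \<inter> E j))"
    using insert.prems insert.hyps by (intro measure_UN_le) auto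
  also have "\<dots> \<le> (\<Sum>j\<in>I. \<epsilon>)"
    using insert.prems insert.hyps by (intro sum_mono) auto
  finally have "\<mu> (E i \<inter> ?U) \<le> ?n * \<epsilon>" by simp
  moreover have "?n * (\<delta> - ?n * \<epsilon>) \<le> \<mu> ?U"
    using insert.prems by (intro insert.IH) auto
  moreover have "\<delta> \<le> \<mu> (E i)" using insert.prems by auto
  ultimately have "?n * (\<delta> - ?n * \<epsilon>) + \<delta> - ?n * \<epsilon> \<le> \<mu> (E i \<union> ?U)"
    using measure_Un[OF M] by linarith
  \<comment> \<open>The two sides differ by \<open>(?n + 1) * \<epsilon>\<close>: the quadratic loss
    is an overestimate, chosen so that the induction closes.\<close>
  moreover have "(?n + 1) * (\<delta> - (?n + 1) * \<epsilon>) \<le> ?n * (\<delta> - ?n * \<epsilon>) + \<delta> - ?n * \<epsilon>"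
    using \<open>0 \<le> \<epsilon>\<close> mult_nonneg_nonneg[of ?n \<epsilon>] by (simp add: algebra_simps)
  ultimately show ?case using insert.hyps by (simp add: add.commute)
qed

text \<open>Otherwise each \<open>E i\<close> meets all but finitely many others in measure below
  any prescribed \<open>\<epsilon>\<close>. Then arbitrarily many almost disjoint sets of measure at
  least \<open>\<delta>\<close> can be found, and their union outgrows the whole space.\<close>

lemma infinite_large_Int:
  fixes E :: "'i \<Rightarrow> 'a set"
  assumes E: "\<And>i. i \<in> J \<Longrightarrow> E i \<in> M" "\<And>i. i \<in> J \<Longrightarrow> \<delta> \<le> \<mu> (E i)" and "0 < \<delta>" "infinite J"
  shows "\<exists>i\<in>J. \<exists>\<epsilon>>0. infinite {j\<in>J. \<epsilon> \<le> \<mu> (E i \<inter> E j)}"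
proof (rule ccontr)
  assume contra: "\<not> ?thesis"
  \<comment> \<open>Greedy choice: by \<open>contra\<close> every index already chosen rules out
    only finitely many further indices, and \<open>J\<close> is infinite.\<close>
  have select: "\<exists>S\<subseteq>J. finite S \<and> card S = n \<and>
      (\<forall>i\<in>S. \<forall>j\<in>S. i \<noteq> j \<longrightarrow> \<mu> (E i \<inter> E j) \<le> \<epsilon>)" if "0 < \<epsilon>" for \<epsilon> and n :: nat
  proof (induction n)
    case 0
    show ?case by (rule exI[of _ "{}"]) auto
  next
    case (Suc n)
    then obtain S where S: "S \<subseteq> J" "finite S" "card S = n"
      "\<And>i j. i \<in> S \<Longrightarrow> j \<in> S \<Longrightarrow> i \<noteq> j \<Longrightarrow> \<mu> (E i \<inter> E j) \<le> \<epsilon>" by blast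
    have "finite (S \<union> (\<Union>i\<in>S. {j\<in>J. \<epsilon> \<le> \<mu> (E i \<inter> E j)}))"
      using S contra that by blast
    from Diff_infinite_finite[OF this \<open>infinite J\<close>]
    obtain j where "j \<in> J - (S \<union> (\<Union>i\<in>S. {j\<in>J. \<epsilon> \<le> \<mu> (E i \<inter> E j)}))"
      using infinite_imp_nonempty by blast
    then have j: "j \<in> J" "j \<notin> S" "\<And>i. i \<in> S \<Longrightarrow> \<not> \<epsilon> \<le> \<mu> (E i \<inter> E j)"
      by auto
    have "\<mu> (E i \<inter> E j) \<le> \<epsilon>" "\<mu> (E j \<inter> E i) \<le> \<epsilon>" if "i \<in> S" for i
      using j(3)[OF that] by (simp_all add: Int_commute)
    then show ?case
      using S j by (intro exI[of _ "insert j S"]) auto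
  qed
  obtain n :: nat where n: "2 * \<mu> \<Omega> / \<delta> < n" using reals_Archimedean2 by blast
  have "0 < n" using n nonneg[OF top] \<open>0 < \<delta>\<close>
    by (metis divide_nonneg_pos gr0I mult_nonneg_nonneg not_less of_nat_0 zero_le_numeral)
  \<comment> \<open>With this value the lower bound \<open>n * (\<delta> - n * \<epsilon>)\<close>
    equals \<open>n * \<delta> / 2\<close>, which exceeds the total measure by the choice of
    \<open>n\<close>.\<close>
  define \<epsilon> where "\<epsilon> = \<delta> / (2 * n)"
  have "0 < \<epsilon>" using \<open>0 < \<delta>\<close> \<open>0 < n\<close> by (simp add: \<epsilon>_def)
  from select[OF this, of n] obtain S where S: "S \<subseteq> J" "finite S" "card S = n"
    "\<And>i j. i \<in> S \<Longrightarrow> j \<in> S \<Longrightarrow> i \<noteq> j \<Longrightarrow> \<mu> (E i \<inter> E j) \<le> \<epsilon>" by blast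
  have "\<mu> \<Omega> < n * (\<delta> - n * \<epsilon>)"
    using n \<open>0 < \<delta>\<close> \<open>0 < n\<close> by (simp add: \<epsilon>_def field_simps)
  also have "\<dots> \<le> \<mu> (\<Union>i\<in>S. E i)"
    using measure_UN_ge[of S E \<delta> \<epsilon>] S E \<open>0 < \<epsilon>\<close> by (auto simp: subset_iff)
  also have "\<dots> \<le> \<mu> \<Omega>"
  proof (rule measure_mono)
    show "(\<Union>i\<in>S. E i) \<in> M" using S E by (intro finite_UN) auto
    then show "(\<Union>i\<in>S. E i) \<subseteq> \<Omega>" using space_closed by blast
  qed simp
  finally show False by simp
qed

text \<open>Nonemptiness of the running intersection is too weak to be carried through a recursion.
  The invariant \<open>good\<close> asks instead that the intersection meet infinitely many
  \<open>E j\<close> in measure bounded away from 0. \<open>infinite_large_Int\<close>, applied to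
  the traces \<open>D \<inter> E j\<close>, restores it at each step, with a smaller bound.\<close>

lemma subsequence_Int_nonempty:
  fixes E :: "nat \<Rightarrow> 'a set"
  assumes E: "\<And>i. E i \<in> M" "\<And>i. \<delta> \<le> \<mu> (E i)" and "0 < \<delta>"
  shows "\<exists>q :: nat \<Rightarrow> nat. strict_mono q \<and> (\<forall>n. (\<Inter>i\<le>n. E (q i)) \<noteq> {})"
proof -
  define good where "good D \<longleftrightarrow> D \<in> M \<and> (\<exists>\<epsilon>>0. infinite {j. \<epsilon> \<le> \<mu> (D \<inter> E j)})" for D
  have good_space: "good \<Omega>"
  proof -
    have "\<Omega> \<inter> E j = E j" for j using E(1) sets_into_space by blast
    then show ?thesis using E \<open>0 < \<delta>\<close> by (auto simp: good_def)
  qed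
  have good_step: "\<exists>i>k. good (D \<inter> E i)" if D: "good D" for D k
  proof -
    obtain \<epsilon> where \<epsilon>: "0 < \<epsilon>" "infinite {j. \<epsilon> \<le> \<mu> (D \<inter> E j)}" using D by (auto simp: good_def)
    \<comment> \<open>Discarding the indices up to \<open>k\<close> keeps the set infinite and
      forces the next index beyond the last one.\<close>
    define J where "J = {j. \<epsilon> \<le> \<mu> (D \<inter> E j)} - {..k}"
    have "infinite J" using \<epsilon> by (simp add: J_def)
    moreover have "D \<inter> E j \<in> M" for j using D E by (auto simp: good_def)
    moreover have "\<epsilon> \<le> \<mu> (D \<inter> E j)" if "j \<in> J" for j using that by (simp add: J_def)
    ultimately obtain i \<eta> where i: "i \<in> J" "0 < \<eta>"
      "infinite {j\<in>J. \<eta> \<le> \<mu> ((D \<inter> E i) \<inter> (D \<inter> E j))}"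
      using infinite_large_Int[of J "\<lambda>j. D \<inter> E j" \<epsilon>] \<epsilon>(1) by blast
    have "(D \<inter> E i) \<inter> (D \<inter> E j) = (D \<inter> E i) \<inter> E j" for j by blast
    then have "infinite {j. \<eta> \<le> \<mu> ((D \<inter> E i) \<inter> E j)}"
      using i(3) by (auto elim!: infinite_super[rotated])
    then have "good (D \<inter> E i)" using i(2) \<open>\<And>j. D \<inter> E j \<in> M\<close> by (auto simp: good_def)
    moreover have "k < i" using i(1) by (simp add: J_def)
    ultimately show ?thesis by blast
  qed
  \<comment> \<open>A state is a pair of the last index used and the current intersection.\<close>
  have "\<exists>f. \<forall>n. good (snd (f n)) \<and>
      (fst (f n) < fst (f (Suc n)) \<and> snd (f (Suc n)) = snd (f n) \<inter> E (fst (f (Suc n))))"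
  proof (rule dependent_nat_choice)
    show "\<exists>x. good (snd x)" using good_space by auto
  next
    fix x :: "nat \<times> 'a set"
    assume "good (snd x)"
    then obtain i where "i > fst x" "good (snd x \<inter> E i)" using good_step by blast
    then show "\<exists>y. good (snd y) \<and> fst x < fst y \<and> snd y = snd x \<inter> E (fst y)"
      by (intro exI[of _ "(i, snd x \<inter> E i)"]) simp
  qed
  then obtain f where f: "\<And>n. good (snd (f n))" "\<And>n. fst (f n) < fst (f (Suc n))"
    "\<And>n. snd (f (Suc n)) = snd (f n) \<inter> E (fst (f (Suc n)))" by blast
  \<comment> \<open>The shift skips the initial state, which is an arbitrary good set with an
    arbitrary index and records no choice of an \<open>E i\<close>.\<close>
  define q where "q n = fst (f (Suc n))" for n
  have "strict_mono q" using f(2) by (simp add: q_def strict_mono_Suc_iff)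
  moreover have "(\<Inter>i\<le>n. E (q i)) \<noteq> {}" for n
  proof -
    have "snd (f (Suc n)) \<subseteq> (\<Inter>i\<le>n. E (q i))"
    proof (induction n)
      case 0
      then show ?case using f(3)[of 0] by (simp add: q_def)
    next
      case (Suc n)
      then show ?case using f(3)[of "Suc n"] by (auto simp: q_def atMost_Suc)
    qed
    moreover have "snd (f (Suc n)) \<noteq> {}"
      using f(1)[of "Suc n"] by (auto simp: good_def measure_empty)
    ultimately show ?thesis by blast
  qed
  ultimately show ?thesis by blast
qed

end

section \<open>The Boolean algebra of stable sets\<close>

text \<open>Ramsey's theorem for two relations that cover all increasing pairs. An unordered pair is
  coloured by whether \<open>P\<close> holds from its minimum to its maximum, so that colour 1
  entails \<open>Q\<close>; the homogeneous set is then enumerated increasingly.\<close>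

lemma Ramsey_nat_pairs:
  fixes P Q :: "nat \<Rightarrow> nat \<Rightarrow> bool"
  assumes "\<And>i j. i < j \<Longrightarrow> P i j \<or> Q i j"
  shows "\<exists>h :: nat \<Rightarrow> nat. strict_mono h \<and> ((\<forall>i j. i < j \<longrightarrow> P (h i) (h j)) \<or> (\<forall>i j. i < j \<longrightarrow> Q (h i) (h j)))"
proof -
  define c :: "nat set \<Rightarrow> nat" where "c X = (if P (Min X) (Max X) then 0 else 1)" for X
  have "\<forall>x\<in>UNIV. \<forall>y\<in>UNIV. x \<noteq> y \<longrightarrow> c {x, y} < 2" by (simp add: c_def)
  from Ramsey2[OF infinite_UNIV_nat this]
  obtain Y t where Y: "infinite Y" "\<forall>x\<in>Y. \<forall>y\<in>Y. x \<noteq> y \<longrightarrow> c {x, y} = t"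
    by blast
  have h: "strict_mono (enumerate Y)" "\<And>n. enumerate Y n \<in> Y"
    using Y(1) by (simp_all add: strict_mono_enumerate enumerate_in_set)
  have c: "c {enumerate Y i, enumerate Y j} = (if P (enumerate Y i) (enumerate Y j) then 0 else 1)"
    and less: "enumerate Y i < enumerate Y j" if "i < j" for i j
  proof -
    show "enumerate Y i < enumerate Y j" using h(1) that by (simp add: strict_mono_less)
    then show "c {enumerate Y i, enumerate Y j} = (if P (enumerate Y i) (enumerate Y j) then 0 else 1)"
      by (simp add: c_def)
  qed
  have t: "c {enumerate Y i, enumerate Y j} = t" if "i < j" for i j
    using Y(2) h(2) less[OF that] by (simp add: less_imp_neq)
  show ?thesis
  proof (cases "t = 0")
    case True
    then have "P (enumerate Y i) (enumerate Y j)" if "i < j" for i j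
      using t[OF that] c[OF that] by (simp split: if_splits)
    then show ?thesis using h(1) by blast
  next
    case False
    then have "Q (enumerate Y i) (enumerate Y j)" if "i < j" for i j
      using t[OF that] c[OF that] assms[OF less[OF that]] by auto
    then show ?thesis using h(1) by blast
  qed
qed

text \<open>The right-hand condition ignores the diagonal and the direction of the order. An
  infinite linear order yields it because distinct indices are related in exactly one direction.
  Conversely, Ramsey's theorem makes membership constant for \<open>i < j\<close>, hence opposite
  for \<open>i > j\<close>, and this is a half-graph up to the diagonal.\<close>

lemma unstable_iff:
  fixes G :: "('a, 'm) monoid_scheme"
  shows "\<not> stable_set G A \<longleftrightarrow>
    (\<exists>a b. range a \<subseteq> carrier G \<and> range b \<subseteq> carrier G \<and>
      (\<forall>i j :: nat. i < j \<longrightarrow> (a i \<otimes>\<^bsub>G\<^esub> b j \<in> A \<longleftrightarrow> a j \<otimes>\<^bsub>G\<^esub> b i \<notin> A)))"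
    (is "_ \<longleftrightarrow> ?R")
proof
  assume "\<not> stable_set G A"
  then obtain I :: "'a set" and r a b where I: "infinite I" "linear_order_on I r"
    "a \<in> I \<rightarrow> carrier G" "b \<in> I \<rightarrow> carrier G"
    and iff: "\<And>i j. i \<in> I \<Longrightarrow> j \<in> I \<Longrightarrow> a i \<otimes>\<^bsub>G\<^esub> b j \<in> A \<longleftrightarrow> (i, j) \<in> r"
    unfolding stable_set_def by blast
  \<comment> \<open>Any injective sequence will do: it need not be monotone, since only one relation
    of each two opposite ones must hold.\<close>
  obtain e :: "nat \<Rightarrow> 'a" where e: "inj e" "range e \<subseteq> I"
    using I(1) infinite_countable_subset by blast
  have "a (e i) \<otimes>\<^bsub>G\<^esub> b (e j) \<in> A \<longleftrightarrow> a (e j) \<otimes>\<^bsub>G\<^esub> b (e i) \<notin> A" if "i < j" for i j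
  proof -
    have "e i \<noteq> e j" using e(1) that by (auto dest: injD)
    moreover have "e i \<in> I" "e j \<in> I" using e(2) by auto
    ultimately show ?thesis
      using I(2) iff by (auto simp: order_on_defs total_on_def dest: antisymD)
  qed
  moreover have "range (a \<circ> e) \<subseteq> carrier G" "range (b \<circ> e) \<subseteq> carrier G"
    using e(2) I(3,4) by auto
  ultimately show ?R by (intro exI[of _ "a \<circ> e"] exI[of _ "b \<circ> e"]) simp
next
  assume ?R
  then obtain a b where ab: "range a \<subseteq> carrier G" "range b \<subseteq> carrier G"
    and alt: "\<And>i j :: nat. i < j \<Longrightarrow> a i \<otimes>\<^bsub>G\<^esub> b j \<in> A \<longleftrightarrow> a j \<otimes>\<^bsub>G\<^esub> b i \<notin> A" by blast
  obtain h :: "nat \<Rightarrow> nat" where h: "strict_mono h"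
    "(\<forall>i j. i < j \<longrightarrow> a (h i) \<otimes>\<^bsub>G\<^esub> b (h j) \<in> A) \<or> (\<forall>i j. i < j \<longrightarrow> a (h i) \<otimes>\<^bsub>G\<^esub> b (h j) \<notin> A)"
    using Ramsey_nat_pairs[of "\<lambda>i j. a i \<otimes>\<^bsub>G\<^esub> b j \<in> A" "\<lambda>i j. a i \<otimes>\<^bsub>G\<^esub> b j \<notin> A"] by blast
  have alt': "a (h i) \<otimes>\<^bsub>G\<^esub> b (h j) \<in> A \<longleftrightarrow> a (h j) \<otimes>\<^bsub>G\<^esub> b (h i) \<notin> A" if "i < j" for i j
    using alt h(1) that by (simp add: strict_mono_less)
  have maps: "(\<lambda>i. a (f i)) \<in> UNIV \<rightarrow> carrier G" "(\<lambda>i. b (g i)) \<in> UNIV \<rightarrow> carrier G"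
    for f g :: "nat \<Rightarrow> nat"
    using ab by auto
  \<comment> \<open>This moves the index set from subsets of the element type to
    \<open>nat\<close>.\<close>
  note no_order = no_order_of_stable_set[of G A "UNIV :: nat set", OF _ infinite_UNIV_nat]
  show "\<not> stable_set G A"
    using h(2)
  proof
    assume up: "\<forall>i j. i < j \<longrightarrow> a (h i) \<otimes>\<^bsub>G\<^esub> b (h j) \<in> A"
    \<comment> \<open>Nothing is known about products with equal indices. Even indices for
      \<open>a\<close> and odd ones for \<open>b\<close> avoid them, and
      \<open>2 * i < 2 * j + 1\<close> holds iff \<open>i \<le> j\<close>, which puts the diagonal
      into the order.\<close>
    have "\<forall>i\<in>UNIV. \<forall>j\<in>UNIV.
        a (h (2 * i)) \<otimes>\<^bsub>G\<^esub> b (h (2 * j + 1)) \<in> A \<longleftrightarrow> (i, j) \<in> {(i, j). i \<le> j}"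
    proof (intro ballI)
      fix i j :: nat
      have "i \<le> j \<or> 2 * j + 1 < 2 * i" "i \<le> j \<Longrightarrow> 2 * i < 2 * j + 1" by linarith+
      then show "a (h (2 * i)) \<otimes>\<^bsub>G\<^esub> b (h (2 * j + 1)) \<in> A \<longleftrightarrow> (i, j) \<in> {(i, j). i \<le> j}"
        using up alt'[of "2 * j + 1" "2 * i"] by auto
    qed
    moreover have "linear_order {(i, j :: nat). i \<le> j}"
      by (auto simp: order_on_defs refl_on_def trans_def antisym_def total_on_def)
    ultimately show ?thesis
      using no_order[OF _ _ maps(1)[of "\<lambda>i. h (2 * i)"] maps(2)[of "\<lambda>j. h (2 * j + 1)"]] by iprover
  next
    assume down: "\<forall>i j. i < j \<longrightarrow> a (h i) \<otimes>\<^bsub>G\<^esub> b (h j) \<notin> A"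
    \<comment> \<open>Here the products with the larger index on \<open>a\<close> lie in
      \<open>A\<close>. The parities are exchanged and the order is the reverse one.\<close>
    have "\<forall>i\<in>UNIV. \<forall>j\<in>UNIV.
        a (h (2 * i + 1)) \<otimes>\<^bsub>G\<^esub> b (h (2 * j)) \<in> A \<longleftrightarrow> (i, j) \<in> {(i, j). j \<le> i}"
    proof (intro ballI)
      fix i j :: nat
      have "j \<le> i \<or> 2 * i + 1 < 2 * j" "j \<le> i \<Longrightarrow> 2 * j < 2 * i + 1" by linarith+
      then show "a (h (2 * i + 1)) \<otimes>\<^bsub>G\<^esub> b (h (2 * j)) \<in> A \<longleftrightarrow> (i, j) \<in> {(i, j). j \<le> i}"
        using down alt'[of "2 * j" "2 * i + 1"] by auto
    qed
    moreover have "linear_order {(i, j :: nat). j \<le> i}"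
      by (auto simp: order_on_defs refl_on_def trans_def antisym_def total_on_def)
    ultimately show ?thesis
      using no_order[OF _ _ maps(1)[of "\<lambda>i. h (2 * i + 1)"] maps(2)[of "\<lambda>j. h (2 * j)"]] by iprover
  qed
qed

lemma unstableI:
  assumes "\<And>i. a i \<in> carrier G" "\<And>i. b i \<in> carrier G"
    and "\<And>i j :: nat. i < j \<Longrightarrow> a i \<otimes>\<^bsub>G\<^esub> b j \<in> A \<longleftrightarrow> a j \<otimes>\<^bsub>G\<^esub> b i \<notin> A"
  shows "\<not> stable_set G A"
  unfolding unstable_iff
  by (rule exI[of _ a], rule exI[of _ b]) (use assms in \<open>simp add: image_subset_iff\<close>)

lemma unstableE:
  assumes "\<not> stable_set G A"
  obtains a b where "\<forall>i. a i \<in> carrier G" "\<forall>i. b i \<in> carrier G"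
    and "\<forall>i j :: nat. i < j \<longrightarrow> a i \<otimes>\<^bsub>G\<^esub> b j \<in> A \<longleftrightarrow> a j \<otimes>\<^bsub>G\<^esub> b i \<notin> A"
  using assms unfolding unstable_iff by (elim exE conjE) (rule that, simp_all add: image_subset_iff)

text \<open>If exactly one of two elements lies in \<open>A \<union> B\<close>, the other lies in
  neither set, so exactly one of them lies in \<open>A\<close> or exactly one lies in
  \<open>B\<close>. Ramsey's theorem gives a subsequence on which the same set serves for all
  pairs.\<close>

lemma stable_set_Un:
  assumes "stable_set G A" "stable_set G B"
  shows "stable_set G (A \<union> B)"
proof (rule ccontr)
  assume "\<not> stable_set G (A \<union> B)"
  then obtain a b where ab: "\<forall>i. a i \<in> carrier G" "\<forall>i. b i \<in> carrier G"
    and alt: "\<forall>i j :: nat. i < j \<longrightarrow> a i \<otimes>\<^bsub>G\<^esub> b j \<in> A \<union> B \<longleftrightarrow> a j \<otimes>\<^bsub>G\<^esub> b i \<notin> A \<union> B"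
    by (rule unstableE)
  define P where "P C i j \<longleftrightarrow> (a i \<otimes>\<^bsub>G\<^esub> b j \<in> C \<longleftrightarrow> a j \<otimes>\<^bsub>G\<^esub> b i \<notin> C)" for C i j
  have "P A i j \<or> P B i j" if "i < j" for i j using alt that by (auto simp: P_def)
  from Ramsey_nat_pairs[of "P A" "P B", OF this]
  obtain h where "(\<forall>i j. i < j \<longrightarrow> P A (h i) (h j)) \<or> (\<forall>i j :: nat. i < j \<longrightarrow> P B (h i) (h j))"
    by blast
  then obtain C where C: "C \<in> {A, B}" "\<forall>i j. i < j \<longrightarrow> P C (h i) (h j)" by blast
  have "\<not> stable_set G C"
    by (rule unstableI[of "\<lambda>i. a (h i)" G "\<lambda>i. b (h i)"]) (use ab C(2) in \<open>simp_all add: P_def\<close>)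
  then show False using assms C(1) by blast
qed

context group
begin

text \<open>The symmetric condition is unchanged when membership is negated, and all products
  involved lie in the carrier.\<close>

lemma stable_set_compl:
  assumes "stable_set G A"
  shows "stable_set G (carrier G - A)"
proof (rule ccontr)
  assume "\<not> stable_set G (carrier G - A)"
  then obtain a b where ab: "\<forall>i. a i \<in> carrier G" "\<forall>i. b i \<in> carrier G"
    "\<forall>i j :: nat. i < j \<longrightarrow> a i \<otimes> b j \<in> carrier G - A \<longleftrightarrow> a j \<otimes> b i \<notin> carrier G - A"
    by (rule unstableE)
  have "\<not> stable_set G A"
  proof (rule unstableI[of a G b])
    fix i j :: nat
    assume "i < j"
    moreover have "a i \<otimes> b j \<in> carrier G" "a j \<otimes> b i \<in> carrier G" using ab(1,2) by simp_all
    ultimately show "a i \<otimes> b j \<in> A \<longleftrightarrow> a j \<otimes> b i \<notin> A" using ab(3) by blast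
  qed (use ab in simp_all)
  then show False using assms by blast
qed

lemma stable_sets_algebra: "algebra (carrier G) (stable_sets G)"
proof -
  have "stable_set G {}"
  proof (rule ccontr)
    assume "\<not> stable_set G {}"
    then obtain a b where "\<forall>i j :: nat. i < j \<longrightarrow> a i \<otimes> b j \<in> {} \<longleftrightarrow> a j \<otimes> b i \<notin> {}"
      by (rule unstableE)
    then show False using zero_less_one by blast
  qed
  then show ?thesis
    by (auto simp: algebra_iff_Un stable_sets_def stable_set_Un stable_set_compl)
qed

section \<open>Translates and inverses of stable sets\<close>

lemma l_coset_mem_iff:
  assumes "A \<subseteq> carrier G" "g \<in> carrier G" "x \<in> carrier G"
  shows "x \<in> g <# A \<longleftrightarrow> inv g \<otimes> x \<in> A"
proof
  assume "x \<in> g <# A"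
  then obtain a where a: "a \<in> A" "x = g \<otimes> a" by (auto simp: l_coset_def)
  then have "inv g \<otimes> x = (inv g \<otimes> g) \<otimes> a"
    using assms m_assoc[of "inv g" g a] by auto
  then show "inv g \<otimes> x \<in> A" using a assms by auto
next
  assume "inv g \<otimes> x \<in> A"
  moreover have "x = g \<otimes> (inv g \<otimes> x)" using assms m_assoc[of g "inv g" x] by simp
  ultimately show "x \<in> g <# A" by (auto simp: l_coset_def)
qed

lemma r_coset_mem_iff:
  assumes "A \<subseteq> carrier G" "g \<in> carrier G" "x \<in> carrier G"
  shows "x \<in> A #> g \<longleftrightarrow> x \<otimes> inv g \<in> A"
proof
  assume "x \<in> A #> g"
  then obtain a where a: "a \<in> A" "x = a \<otimes> g" by (auto simp: r_coset_def)
  then have "x \<otimes> inv g = a \<otimes> (g \<otimes> inv g)"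
    using assms m_assoc[of a g "inv g"] by auto
  then show "x \<otimes> inv g \<in> A" using a assms by auto
next
  assume "x \<otimes> inv g \<in> A"
  moreover have "x = (x \<otimes> inv g) \<otimes> g" using assms by (simp add: m_assoc)
  ultimately show "x \<in> A #> g" by (auto simp: r_coset_def)
qed

lemma set_inv_mem_iff:
  assumes "A \<subseteq> carrier G" "x \<in> carrier G"
  shows "x \<in> set_inv A \<longleftrightarrow> inv x \<in> A"
  using assms by (auto simp: SET_INV_def subset_iff intro!: bexI[of _ "inv x"])

lemma set_inv_subset: "A \<subseteq> carrier G \<Longrightarrow> set_inv A \<subseteq> carrier G"
  by (auto simp: SET_INV_def)

lemma set_inv_inv:
  assumes "A \<subseteq> carrier G"
  shows "set_inv (set_inv A) = A"
  using assms by (force simp: SET_INV_def)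

text \<open>A left translation is absorbed into the sequence \<open>a\<close>; in the next lemma a
  right translation is absorbed into \<open>b\<close>.\<close>

lemma l_coset_stable:
  assumes "A \<in> stable_sets G" "g \<in> carrier G"
  shows "g <# A \<in> stable_sets G"
proof -
  have A: "A \<subseteq> carrier G" using assms by (simp add: stable_sets_def)
  have "stable_set G (g <# A)"
  proof (rule ccontr)
    assume "\<not> stable_set G (g <# A)"
    then obtain a b where ab: "\<forall>i. a i \<in> carrier G" "\<forall>i. b i \<in> carrier G"
      "\<forall>i j :: nat. i < j \<longrightarrow> a i \<otimes> b j \<in> g <# A \<longleftrightarrow> a j \<otimes> b i \<notin> g <# A"
      by (rule unstableE)
    have "\<not> stable_set G A"
      by (rule unstableI[of "\<lambda>i. inv g \<otimes> a i" G b])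
        (use ab assms A in \<open>simp_all add: l_coset_mem_iff m_assoc\<close>)
    then show False using assms by (simp add: stable_sets_def)
  qed
  then show ?thesis using A assms by (simp add: stable_sets_def l_coset_subset_G)
qed

lemma r_coset_stable:
  assumes "A \<in> stable_sets G" "g \<in> carrier G"
  shows "A #> g \<in> stable_sets G"
proof -
  have A: "A \<subseteq> carrier G" using assms by (simp add: stable_sets_def)
  have "stable_set G (A #> g)"
  proof (rule ccontr)
    assume "\<not> stable_set G (A #> g)"
    then obtain a b where ab: "\<forall>i. a i \<in> carrier G" "\<forall>i. b i \<in> carrier G"
      "\<forall>i j :: nat. i < j \<longrightarrow> a i \<otimes> b j \<in> A #> g \<longleftrightarrow> a j \<otimes> b i \<notin> A #> g"
      by (rule unstableE)
    have "\<not> stable_set G A"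
      by (rule unstableI[of a G "\<lambda>i. b i \<otimes> inv g"])
        (use ab assms A in \<open>simp_all add: r_coset_mem_iff m_assoc[symmetric]\<close>)
    then show False using assms by (simp add: stable_sets_def)
  qed
  then show ?thesis using A assms by (simp add: stable_sets_def r_coset_subset_G)
qed

text \<open>Inverting a product reverses its factors, so the inverses of \<open>b\<close> and
  \<open>a\<close> exchange their roles; the symmetric condition is insensitive to this.\<close>

lemma set_inv_stable:
  assumes "A \<in> stable_sets G"
  shows "set_inv A \<in> stable_sets G"
proof -
  have A: "A \<subseteq> carrier G" using assms by (simp add: stable_sets_def)
  have "stable_set G (set_inv A)"
  proof (rule ccontr)
    assume "\<not> stable_set G (set_inv A)"
    then obtain a b where ab: "\<forall>i. a i \<in> carrier G" "\<forall>i. b i \<in> carrier G"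
      "\<forall>i j :: nat. i < j \<longrightarrow> a i \<otimes> b j \<in> set_inv A \<longleftrightarrow> a j \<otimes> b i \<notin> set_inv A"
      by (rule unstableE)
    have "\<not> stable_set G A"
    proof (rule unstableI[of "\<lambda>i. inv (b i)" G "\<lambda>i. inv (a i)"])
      fix i j :: nat
      assume "i < j"
      moreover have "inv (b k) \<otimes> inv (a l) \<in> A \<longleftrightarrow> a l \<otimes> b k \<in> set_inv A" for k l
        using ab(1,2) by (simp add: set_inv_mem_iff[OF A] inv_mult_group)
      ultimately show "inv (b i) \<otimes> inv (a j) \<in> A \<longleftrightarrow> inv (b j) \<otimes> inv (a i) \<notin> A"
        using ab(3) by blast
    qed (use ab in simp_all)
    then show False using assms by (simp add: stable_sets_def)
  qed
  then show ?thesis using A by (simp add: stable_sets_def set_inv_subset)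
qed

lemma stable_prob_measure_finitely_additive:
  assumes "stable_prob_measure G \<mu>"
  shows "finitely_additive_measure (carrier G) (stable_sets G) \<mu>"
  using assms stable_sets_algebra
  unfolding finitely_additive_measure_def finitely_additive_measure_axioms_def stable_prob_measure_def
  by blast

section \<open>Generic sets and measure\<close>

text \<open>Any \<open>y\<close> outside \<open>set_inv S <#> A\<close> works, since
  \<open>s \<otimes> y \<in> A\<close> would put \<open>y\<close> into \<open>inv s <# A\<close>. In
  other words, the right translate of \<open>A\<close> by \<open>inv y\<close> misses
  \<open>S\<close>.\<close>

lemma not_generic_avoid:
  assumes "A \<subseteq> carrier G" "\<not> generic G A" "finite S" "S \<subseteq> carrier G"
  shows "\<exists>y\<in>carrier G. \<forall>s\<in>S. s \<otimes> y \<notin> A"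
proof -
  have "set_inv S <#> A \<subseteq> carrier G" using assms set_inv_subset by (intro set_mult_closed)
  moreover have "finite (set_inv S)" using assms by (simp add: SET_INV_def)
  ultimately obtain y where y: "y \<in> carrier G" "y \<notin> set_inv S <#> A"
    using assms(2) set_inv_subset[OF assms(4)] unfolding generic_def by blast
  have "s \<otimes> y \<notin> A" if "s \<in> S" for s
  proof
    assume "s \<otimes> y \<in> A"
    moreover have "y = inv s \<otimes> (s \<otimes> y)" using that assms y by (simp add: m_assoc[symmetric] subset_iff)
    ultimately show False using y(2) that by (auto simp: set_mult_def SET_INV_def)
  qed
  then show ?thesis using y by blast
qed

lemma not_generic_measure_zero:
  assumes A: "A \<in> stable_sets G" and ng: "\<not> generic G A"
    and \<mu>: "stable_prob_measure G \<mu>" "bi_invariant G \<mu>"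
  shows "\<mu> A = 0"
proof (rule ccontr)
  assume "\<mu> A \<noteq> 0"
  interpret finitely_additive_measure "carrier G" "stable_sets G" \<mu>
    using \<mu>(1) by (rule stable_prob_measure_finitely_additive)
  have pos: "0 < \<mu> A" using \<open>\<mu> A \<noteq> 0\<close> nonneg[OF A] by simp
  have AG: "A \<subseteq> carrier G" using A by (simp add: stable_sets_def)
  \<comment> \<open>The witness depends only on the set \<open>T\<close>, so it can be avoided
    before it is known which \<open>T\<close> will matter. If no witness exists, \<open>w T\<close>
    is arbitrary; hence the guard \<open>w T \<in> carrier G\<close> below.\<close>
  define w where "w T = (SOME g. g \<in> carrier G \<and> (\<forall>y\<in>T. g \<otimes> y \<in> A))" for T
  \<comment> \<open>The subsequence is extracted only later, so \<open>y n\<close> must avoid the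
    witnesses of all subsets of the earlier points. There are finitely many of them.\<close>
  have "\<exists>y. \<forall>n :: nat. y n \<in> carrier G \<and>
      (\<forall>T\<subseteq>y ` {..<n}. w T \<in> carrier G \<longrightarrow> w T \<otimes> y n \<notin> A)"
  proof (rule dependent_wellorder_choice)
    fix z :: 'a and f g :: "nat \<Rightarrow> 'a" and n :: nat
    assume "\<And>m. m < n \<Longrightarrow> f m = g m"
    then have "f ` {..<n} = g ` {..<n}" by (intro image_cong) auto
    then show "(z \<in> carrier G \<and> (\<forall>T\<subseteq>f ` {..<n}. w T \<in> carrier G \<longrightarrow> w T \<otimes> z \<notin> A)) =
        (z \<in> carrier G \<and> (\<forall>T\<subseteq>g ` {..<n}. w T \<in> carrier G \<longrightarrow> w T \<otimes> z \<notin> A))" by simp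
  next
    fix f :: "nat \<Rightarrow> 'a" and n :: nat
    have "finite (w ` Pow (f ` {..<n}) \<inter> carrier G)" by simp
    then show "\<exists>z. z \<in> carrier G \<and> (\<forall>T\<subseteq>f ` {..<n}. w T \<in> carrier G \<longrightarrow> w T \<otimes> z \<notin> A)"
      using not_generic_avoid[OF AG ng, of "w ` Pow (f ` {..<n}) \<inter> carrier G"] by blast
  qed
  then obtain y where y: "\<And>n :: nat. y n \<in> carrier G"
    and avoid: "\<And>n T. T \<subseteq> y ` {..<n} \<Longrightarrow> w T \<in> carrier G \<Longrightarrow> w T \<otimes> y n \<notin> A" by blast
  \<comment> \<open>\<open>E n\<close> consists of the \<open>g\<close> in the group with
    \<open>g \<otimes> y n \<in> A\<close>; right invariance gives all these sets the measure of
    \<open>A\<close>.\<close>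
  define E where "E n = A #> inv (y n)" for n
  have E: "E n \<in> stable_sets G" "\<mu> (E n) = \<mu> A" for n
    using A y \<mu>(2) by (simp_all add: E_def r_coset_stable bi_invariant_def)
  obtain q :: "nat \<Rightarrow> nat" where q: "strict_mono q" "\<forall>n. (\<Inter>i\<le>n. E (q i)) \<noteq> {}"
    using subsequence_Int_nonempty[of E "\<mu> A", OF E(1) _ pos] E(2) by auto
  define T where "T n = y ` q ` {..n}" for n
  have w: "w (T n) \<in> carrier G" "\<forall>z\<in>T n. w (T n) \<otimes> z \<in> A" for n
  \<comment> \<open>A common point of the first \<open>n + 1\<close> sets \<open>E (q i)\<close>
    shows that the choice defining \<open>w (T n)\<close> has a solution.\<close>
  proof -
    obtain g where g: "\<forall>i\<le>n. g \<in> E (q i)" using q(2) by blast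
    have "g \<in> E (q 0)" using g by simp
    then have gG: "g \<in> carrier G"
      using r_coset_subset_G[OF AG inv_closed[OF y]] by (auto simp: E_def)
    have "g \<otimes> z \<in> A" if z: "z \<in> T n" for z
    proof -
      obtain i where i: "i \<le> n" "z = y (q i)" using z by (auto simp: T_def)
      then have "g \<in> A #> inv (y (q i))" using g by (simp add: E_def)
      then show ?thesis using r_coset_mem_iff[OF AG inv_closed[OF y] gG] y i(2) by simp
    qed
    then have "\<exists>g. g \<in> carrier G \<and> (\<forall>z\<in>T n. g \<otimes> z \<in> A)" using gG by blast
    from someI_ex[OF this, folded w_def]
    show "w (T n) \<in> carrier G" "\<forall>z\<in>T n. w (T n) \<otimes> z \<in> A" by simp_all
  qed
  have "\<not> stable_set G A"
  proof (rule unstableI[of "\<lambda>n. w (T n)" G "y \<circ> q"])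
    fix i j :: nat
    assume "i < j"
    \<comment> \<open>Monotonicity of \<open>q\<close> places \<open>T i\<close> among the points
      chosen before \<open>y (q j)\<close>, which therefore avoids \<open>w (T i)\<close>. In the
      other direction \<open>y (q i)\<close> belongs to \<open>T j\<close>.\<close>
    have "q k < q j" if "k \<le> i" for k using q(1) \<open>i < j\<close> that by (simp add: strict_mono_less)
    then have "T i \<subseteq> y ` {..<q j}" by (auto simp: T_def)
    then have "w (T i) \<otimes> y (q j) \<notin> A" using avoid w(1) by blast
    moreover have "w (T j) \<otimes> y (q i) \<in> A" using w(2)[of j] \<open>i < j\<close> by (auto simp: T_def)
    ultimately show "w (T i) \<otimes> (y \<circ> q) j \<in> A \<longleftrightarrow> w (T j) \<otimes> (y \<circ> q) i \<notin> A" by simp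
  qed (use w y in auto)
  then show False using A by (simp add: stable_sets_def)
qed

text \<open>The group is a finite union of two-sided translates of \<open>A\<close>, all of measure
  \<open>\<mu> A\<close>. If this were 0, subadditivity would give the group measure 0.\<close>

lemma two_sided_cover_measure_pos:
  assumes A: "A \<in> stable_sets G" and \<mu>: "stable_prob_measure G \<mu>" "bi_invariant G \<mu>"
    and E: "finite E" "E \<subseteq> carrier G" and F: "finite F" "F \<subseteq> carrier G"
    and cover: "carrier G = E <#> A <#> F"
  shows "0 < \<mu> A"
proof -
  interpret finitely_additive_measure "carrier G" "stable_sets G" \<mu>
    using \<mu>(1) by (rule stable_prob_measure_finitely_additive)
  define D where "D p = (fst p <# A) #> snd p" for p
  have D: "D p \<in> stable_sets G" "\<mu> (D p) = \<mu> A" if "p \<in> E \<times> F" for p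
    using that A E F \<mu>(2)
    by (auto simp: D_def l_coset_stable r_coset_stable bi_invariant_def subset_iff)
  have "carrier G = (\<Union>p\<in>E \<times> F. D p)"
    using cover by (force simp: D_def set_mult_def l_coset_def r_coset_def)
  then have "1 = \<mu> (\<Union>p\<in>E \<times> F. D p)" using \<mu>(1) by (simp add: stable_prob_measure_def)
  also have "\<dots> \<le> (\<Sum>p\<in>E \<times> F. \<mu> (D p))" using D E F by (intro measure_UN_le) auto
  also have "\<dots> = (\<Sum>p\<in>E \<times> F. \<mu> A)" by (rule sum.cong) (use D in auto)
  finally show ?thesis using nonneg[OF A] by (cases "\<mu> A = 0") auto
qed

lemma generic_imp_two_sided_cover:
  assumes "A \<subseteq> carrier G" "generic G A"
  shows "\<exists>E F. finite E \<and> E \<subseteq> carrier G \<and> finite F \<and> F \<subseteq> carrier G \<and> carrier G = E <#> A <#> F"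
proof -
  obtain E where E: "finite E" "E \<subseteq> carrier G" "carrier G = E <#> A"
    using assms(2) by (auto simp: generic_def)
  have "E <#> A <#> {\<one>} = E <#> A"
    using coset_mult_one[of "E <#> A"] E(3) by (simp add: r_coset_eq_set_mult)
  then have "carrier G = E <#> A <#> {\<one>}" using E(3) by simp
  moreover have "finite {\<one>}" "{\<one>} \<subseteq> carrier G" by simp_all
  ultimately show ?thesis using E(1,2) by blast
qed

lemma generic_iff_measure_pos:
  assumes "A \<in> stable_sets G" "stable_prob_measure G \<mu>" "bi_invariant G \<mu>"
  shows "generic G A \<longleftrightarrow> 0 < \<mu> A"
proof
  assume gen: "generic G A"
  have "A \<subseteq> carrier G" using assms by (simp add: stable_sets_def)
  from generic_imp_two_sided_cover[OF this gen]
  obtain E F where "finite E" "E \<subseteq> carrier G" "finite F" "F \<subseteq> carrier G"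
    "carrier G = E <#> A <#> F" by blast
  then show "0 < \<mu> A" by (rule two_sided_cover_measure_pos[OF assms])
next
  assume "0 < \<mu> A"
  then show "generic G A" using not_generic_measure_zero[OF assms(1) _ assms(2,3)] by (cases "generic G A") simp_all
qed

section \<open>Inversion and right-sided covers\<close>

lemma set_inv_set_mult:
  assumes "A \<subseteq> carrier G" "B \<subseteq> carrier G"
  shows "set_inv (A <#> B) = set_inv B <#> set_inv A"
proof -
  have "inv (a \<otimes> b) = inv b \<otimes> inv a" if "a \<in> A" "b \<in> B" for a b
    using that assms by (intro inv_mult_group) auto
  then show ?thesis unfolding set_mult_def SET_INV_def by force
qed

lemma set_inv_carrier: "set_inv (carrier G) = carrier G"
  using set_inv_subset set_inv_mem_iff by blast

text \<open>Inversion turns \<open>F <#> set_inv A\<close> into \<open>A <#> set_inv F\<close>. This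
  reduces covers by right translates to genericity of the inverse set.\<close>

lemma generic_set_inv_iff:
  assumes A: "A \<subseteq> carrier G"
  shows "generic G (set_inv A) \<longleftrightarrow> (\<exists>F. finite F \<and> F \<subseteq> carrier G \<and> carrier G = A <#> F)"
proof
  assume "generic G (set_inv A)"
  then obtain F where F: "finite F" "F \<subseteq> carrier G" "carrier G = F <#> set_inv A"
    by (auto simp: generic_def)
  then have "carrier G = A <#> set_inv F"
    using set_inv_carrier set_inv_set_mult[OF F(2) set_inv_subset[OF A]] set_inv_inv[OF A] by metis
  moreover have "finite (set_inv F)" using F(1) by (simp add: SET_INV_def)
  ultimately show "\<exists>F. finite F \<and> F \<subseteq> carrier G \<and> carrier G = A <#> F"
    using set_inv_subset[OF F(2)] by blast
next
  assume "\<exists>F. finite F \<and> F \<subseteq> carrier G \<and> carrier G = A <#> F"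
  then obtain F where F: "finite F" "F \<subseteq> carrier G" "carrier G = A <#> F" by blast
  then have "carrier G = set_inv F <#> set_inv A"
    using set_inv_carrier set_inv_set_mult[OF A F(2)] by metis
  moreover have "finite (set_inv F)" using F(1) by (simp add: SET_INV_def)
  ultimately show "generic G (set_inv A)"
    using set_inv_subset[OF F(2)] by (auto simp: generic_def)
qed

text \<open>Supplies the competitor to which uniqueness of \<open>\<mu>\<close> is applied.
  Inversion interchanges left and right translation, so invariance on each side comes from
  invariance of \<open>\<mu>\<close> on the other.\<close>

lemma set_inv_measure:
  assumes "stable_prob_measure G \<mu>" "bi_invariant G \<mu>"
  shows "stable_prob_measure G (\<lambda>A. \<mu> (set_inv A))" "bi_invariant G (\<lambda>A. \<mu> (set_inv A))"
proof -
  have "set_inv (A \<union> B) = set_inv A \<union> set_inv B" for A B by (auto simp: SET_INV_def)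
  moreover have "set_inv A \<inter> set_inv B = {}"
    if "A \<in> stable_sets G" "B \<in> stable_sets G" "A \<inter> B = {}" for A B
  proof -
    \<comment> \<open>Disjointness passes to the inverse sets because both sets lie in the carrier,
      where \<open>inv\<close> is an involution.\<close>
    have "A \<subseteq> carrier G" "B \<subseteq> carrier G" using that by (auto simp: stable_sets_def)
    then have "inv x \<in> A \<inter> B" if "x \<in> set_inv A \<inter> set_inv B" for x
      using that set_inv_mem_iff set_inv_subset by blast
    then show ?thesis using that(3) by blast
  qed
  ultimately show "stable_prob_measure G (\<lambda>A. \<mu> (set_inv A))"
    using assms(1) by (simp add: stable_prob_measure_def set_inv_stable set_inv_carrier)
  have "set_inv (g <# A) = set_inv A #> inv g" "set_inv (A #> g) = inv g <# set_inv A"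
    if "A \<in> stable_sets G" "g \<in> carrier G" for A g
  proof -
    have A: "A \<subseteq> carrier G" using that by (simp add: stable_sets_def)
    have "set_inv {g} = {inv g}" by (simp add: SET_INV_def)
    then show "set_inv (g <# A) = set_inv A #> inv g" "set_inv (A #> g) = inv g <# set_inv A"
      using set_inv_set_mult[of "{g}" A] set_inv_set_mult[of A "{g}"] A that(2)
      by (simp_all add: l_coset_eq_set_mult r_coset_eq_set_mult)
  qed
  then show "bi_invariant G (\<lambda>A. \<mu> (set_inv A))"
    using assms(2) by (simp add: bi_invariant_def set_inv_stable)
qed

end

theorem theorem4p7:
  fixes G :: "('a, 'm) monoid_scheme" and \<mu> :: "'a set \<Rightarrow> real"
  assumes "group G"
    and "stable_prob_measure G \<mu>" and "bi_invariant G \<mu>"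
    and unique: "\<And>\<nu> A. stable_prob_measure G \<nu> \<Longrightarrow> bi_invariant G \<nu> \<Longrightarrow>
                   A \<in> stable_sets G \<Longrightarrow> \<nu> A = \<mu> A"
  shows "(\<forall>A\<in>stable_sets G. \<forall>B\<in>stable_sets G.
            generic G (A \<union> B) \<longrightarrow> generic G A \<or> generic G B)
       \<and> (\<forall>A\<in>stable_sets G. generic G A \<or> generic G (carrier G - A))
       \<and> (\<forall>A\<in>stable_sets G. \<mu> (set_inv\<^bsub>G\<^esub> A) = \<mu> A)
       \<and> (\<forall>A\<in>stable_sets G.
            (generic G A \<longleftrightarrow>
               (\<exists>F. finite F \<and> F \<subseteq> carrier G \<and> carrier G = A <#>\<^bsub>G\<^esub> F))
          \<and> (generic G A \<longleftrightarrow>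
               (\<exists>E F. finite E \<and> E \<subseteq> carrier G \<and> finite F \<and> F \<subseteq> carrier G \<and>
                  carrier G = E <#>\<^bsub>G\<^esub> A <#>\<^bsub>G\<^esub> F))
          \<and> (generic G A \<longleftrightarrow> 0 < \<mu> A))"
proof -
  interpret group G by fact
  note \<mu> = assms(2,3)
  interpret finitely_additive_measure "carrier G" "stable_sets G" \<mu>
    using \<mu>(1) by (rule stable_prob_measure_finitely_additive)
  note generic_iff = generic_iff_measure_pos[OF _ \<mu>]
  have inv: "\<mu> (set_inv\<^bsub>G\<^esub> A) = \<mu> A" if "A \<in> stable_sets G" for A
    using unique[OF set_inv_measure[OF \<mu>] that] .
  show ?thesis
  proof (intro conjI ballI impI)
    fix A B
    assume AB: "A \<in> stable_sets G" "B \<in> stable_sets G" "generic G (A \<union> B)"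
    then have "0 < \<mu> (A \<union> B)" using generic_iff by blast
    \<comment> \<open>If both measures vanished, inclusion-exclusion would make the measure of the
      union at most 0.\<close>
    then have "0 < \<mu> A \<or> 0 < \<mu> B"
      using measure_Un[OF AB(1,2)] nonneg[of "A \<inter> B"] AB(1,2) by force
    then show "generic G A \<or> generic G B" using generic_iff AB(1,2) by blast
  next
    fix A
    assume A: "A \<in> stable_sets G"
    then have "A \<union> (carrier G - A) = carrier G" by (auto simp: stable_sets_def)
    then have "\<mu> A + \<mu> (carrier G - A) = 1"
      using additive[of A "carrier G - A"] A \<mu>(1) by (auto simp: stable_prob_measure_def)
    then have "0 < \<mu> A \<or> 0 < \<mu> (carrier G - A)" by linarith
    then show "generic G A \<or> generic G (carrier G - A)" using generic_iff A by blast
  next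
    fix A
    assume A: "A \<in> stable_sets G"
    then have AG: "A \<subseteq> carrier G" by (simp add: stable_sets_def)
    show "\<mu> (set_inv\<^bsub>G\<^esub> A) = \<mu> A" by (rule inv[OF A])
    show pos: "generic G A \<longleftrightarrow> 0 < \<mu> A" by (rule generic_iff[OF A])
    \<comment> \<open>A right-sided cover means that the inverse of \<open>A\<close> is generic,
      hence of positive measure, and \<open>inv\<close> equates its measure with that of
      \<open>A\<close>.\<close>
    show "generic G A \<longleftrightarrow> (\<exists>F. finite F \<and> F \<subseteq> carrier G \<and> carrier G = A <#>\<^bsub>G\<^esub> F)"
      using generic_iff[OF set_inv_stable[OF A]] generic_set_inv_iff[OF AG] pos inv[OF A] by simp
    show "generic G A \<longleftrightarrow>
        (\<exists>E F. finite E \<and> E \<subseteq> carrier G \<and> finite F \<and> F \<subseteq> carrier G \<and>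
          carrier G = E <#>\<^bsub>G\<^esub> A <#>\<^bsub>G\<^esub> F)"
      using generic_imp_two_sided_cover[OF AG] two_sided_cover_measure_pos[OF A \<mu>] pos by blast
  qed
qed

end
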